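(* Let $\varphi:\mathbb{D}\to\mathbb{D}$ be holomorphic, $\varphi\notin\mathrm{Aut}(\mathbb{D})$, and suppose there is $\alpha\in\mathbb{D}$ with $\varphi(\alpha)=\alpha$ and $\varphi'(\alpha)\neq0$. Put $\lambda_n=\varphi'(\alpha)^n$ for $n\in\mathbb{N}_0$, let $C_\varphi f=f\circ\varphi$ on $\mathrm{Hol}(\mathbb{D})$, and let $\kappa$ be Koenigs' eigenfunction of $\varphi$. Define iteratively rank-one projections $P_n\in\mathcal{L}(\mathrm{Hol}(\mathbb{D}))$ by $$P_0f=f(\alpha)e_0\quad\text{and, for }n\in\mathbb{N},\quad P_n f=\frac{1}{n!}g^{(n)}(\alpha)\,\kappa^n,\quad\text{where } g=f-\sum_{k=0}^{n-1}P_kf .$$ Then the following holds: (a) $P_nC_\varphi=C_\varphi P_n=\lambda_nP_n$ for all $n\in\mathbb{N}_0$. (b) $f^{(l)}(\alpha)=\left(\sum_{k=0}^nP_kf\right)^{(l)}(\alpha)$ for all $n\in\mathbb{N}_0$, $l=0,\dots,n$ and $f\in\mathrm{Hol}(\mathbb{D})$. (c) There exist complex numbers $c_{n,m}$ ($n,m\in\mathbb{N}_0$) such that $P_nf=\left(\sum_{m=0}^nc_{n,m}f^{(m)}(\alpha)\right)\kappa^n$ for all $n\in\mathbb{N}_0$ and $f\in\mathrm{Hol}(\mathbb{D})$. (d) $P_nP_m=\delta_{n,m}P_n$ for all $n,m\in\mathbb{N}_0$.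
   Context: $\mathbb{D}$ is the open unit disc, $\mathrm{Hol}(\mathbb{D})$ the Fréchet space of holomorphic functions on $\mathbb{D}$ (uniform convergence on compact sets), $\mathcal{L}(\mathrm{Hol}(\mathbb{D}))$ the algebra of continuous linear operators on it, $\mathrm{Aut}(\mathbb{D})$ the group of holomorphic automorphisms of $\mathbb{D}$, $\mathbb{N}_0=\{0,1,2,\dots\}$, $\mathbb{N}=\{1,2,\dots\}$, and $e_0$ is the constant function $1$. Koenigs' eigenfunction $\kappa$ is the unique $\kappa\in\mathrm{Hol}(\mathbb{D})$ with $\kappa\circ\varphi=\varphi'(\alpha)\kappa$ and $\kappa'(\alpha)=1$ (existence and uniqueness: Koenigs' theorem); $\kappa^n$ is its $n$-th power, $\kappa^0=1$. $\delta_{n,m}$ is the Kronecker delta. *)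

theory Defs
  imports "HOL-Complex_Analysis.Complex_Analysis"
begin

abbreviation unit_disc :: "complex set" where
  "unit_disc \<equiv> ball 0 1"

text \<open>Elements are represented by functions on all of the complex plane; the value 0 off the
  disc makes the representation unique, so that equality in this type is equality on the disc.\<close>

typedef hol_disc = "{f :: complex \<Rightarrow> complex. f holomorphic_on unit_disc \<and> (\<forall>z. z \<notin> unit_disc \<longrightarrow> f z = 0)}"
  morphisms hol_fun Abs_hol_disc
  by (rule exI[of _ "\<lambda>_. 0"]) auto

setup_lifting type_definition_hol_disc

lemma hol_fun_holomorphic [holomorphic_intros]: "hol_fun f holomorphic_on unit_disc"
  using hol_fun[of f] by simp

lemma hol_disc_eqI:
  assumes "\<And>z. z \<in> unit_disc \<Longrightarrow> hol_fun f z = hol_fun g z"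
  shows "f = g"
proof -
  have "hol_fun f = hol_fun g"
  proof
    fix z
    show "hol_fun f z = hol_fun g z"
      using assms[of z] hol_fun[of f] hol_fun[of g] by (cases "z \<in> unit_disc") auto
  qed
  then show ?thesis by (simp add: hol_fun_inject)
qed

lemma holomorphic_on_disc_extend_0:
  assumes "f holomorphic_on unit_disc"
  shows "(\<lambda>z. if z \<in> unit_disc then f z else 0) holomorphic_on unit_disc"
  using assms by (rule holomorphic_transform) simp

instantiation hol_disc :: comm_ring_1
begin

lift_definition zero_hol_disc :: hol_disc is "\<lambda>_. 0" by auto

lift_definition one_hol_disc :: hol_disc is "\<lambda>z. if z \<in> unit_disc then 1 else 0"
  by (simp add: holomorphic_on_disc_extend_0 del: mem_ball mem_ball_0)

lift_definition plus_hol_disc :: "hol_disc \<Rightarrow> hol_disc \<Rightarrow> hol_disc" is "\<lambda>f g z. f z + g z"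
  by (auto intro: holomorphic_intros)

lift_definition minus_hol_disc :: "hol_disc \<Rightarrow> hol_disc \<Rightarrow> hol_disc" is "\<lambda>f g z. f z - g z"
  by (auto intro: holomorphic_intros)

lift_definition uminus_hol_disc :: "hol_disc \<Rightarrow> hol_disc" is "\<lambda>f z. - f z"
  by (auto intro: holomorphic_intros)

lift_definition times_hol_disc :: "hol_disc \<Rightarrow> hol_disc \<Rightarrow> hol_disc" is "\<lambda>f g z. f z * g z"
  by (auto intro: holomorphic_intros)

instance
proof
  show "(0::hol_disc) \<noteq> 1"
    by transfer (auto simp: fun_eq_iff intro!: exI[of _ 0])
qed (transfer; auto simp: fun_eq_iff algebra_simps)+

end

lift_definition hol_scale :: "complex \<Rightarrow> hol_disc \<Rightarrow> hol_disc" (infixr "*\<^sub>H" 75)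
  is "\<lambda>c f z. c * f z"
  by (auto intro: holomorphic_intros)

global_interpretation hol: vector_space hol_scale
  by unfold_locales (transfer; auto simp: fun_eq_iff algebra_simps)+

text \<open>The topology of uniform convergence on compact subsets of the disc.\<close>

definition hol_nbhd :: "hol_disc \<Rightarrow> complex set \<Rightarrow> real \<Rightarrow> hol_disc set" where
  "hol_nbhd f K e = {g. \<forall>z\<in>K. dist (hol_fun g z) (hol_fun f z) < e}"

instantiation hol_disc :: topological_space
begin

definition open_hol_disc :: "hol_disc set \<Rightarrow> bool" where
  "open_hol_disc U \<longleftrightarrow>
     (\<forall>f\<in>U. \<exists>K e. compact K \<and> K \<subseteq> unit_disc \<and> e > 0 \<and> hol_nbhd f K e \<subseteq> U)"

instance
proof
  have "compact {} \<and> {} \<subseteq> unit_disc \<and> (1::real) > 0 \<and> hol_nbhd f {} 1 \<subseteq> UNIV" for f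
    by simp
  then show "open (UNIV :: hol_disc set)"
    unfolding open_hol_disc_def by blast
next
  fix S T :: "hol_disc set" assume S: "open S" and T: "open T"
  show "open (S \<inter> T)"
    unfolding open_hol_disc_def
  proof
    fix f assume f: "f \<in> S \<inter> T"
    obtain K d where K: "compact K" "K \<subseteq> unit_disc" "d > 0" "hol_nbhd f K d \<subseteq> S"
      using S f unfolding open_hol_disc_def by (meson IntD1)
    obtain L e where L: "compact L" "L \<subseteq> unit_disc" "e > 0" "hol_nbhd f L e \<subseteq> T"
      using T f unfolding open_hol_disc_def by (meson IntD2)
    have "hol_nbhd f (K \<union> L) (min d e) \<subseteq> hol_nbhd f K d \<inter> hol_nbhd f L e"
      by (auto simp: hol_nbhd_def)
    then have "hol_nbhd f (K \<union> L) (min d e) \<subseteq> S \<inter> T"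
      using K(4) L(4) by (meson Int_mono order_trans)
    moreover have "compact (K \<union> L)" "K \<union> L \<subseteq> unit_disc" "min d e > 0"
      using K(1-3) L(1-3) by (simp_all add: compact_Un)
    ultimately show "\<exists>K e. compact K \<and> K \<subseteq> unit_disc \<and> e > 0 \<and> hol_nbhd f K e \<subseteq> S \<inter> T"
      by meson
  qed
next
  fix \<U> :: "hol_disc set set" assume U: "\<forall>S\<in>\<U>. open S"
  show "open (\<Union>\<U>)"
    unfolding open_hol_disc_def
  proof
    fix f assume "f \<in> \<Union>\<U>"
    then obtain S where S: "S \<in> \<U>" "f \<in> S" by (meson UnionE)
    obtain K e where "compact K" "K \<subseteq> unit_disc" "e > 0" "hol_nbhd f K e \<subseteq> S"
      using U S unfolding open_hol_disc_def by meson
    then show "\<exists>K e. compact K \<and> K \<subseteq> unit_disc \<and> e > 0 \<and> hol_nbhd f K e \<subseteq> \<Union>\<U>"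
      using S(1) by (meson Union_upper order_trans)
  qed
qed

end

lemma open_hol_nbhd:
  assumes K: "compact K" "K \<subseteq> unit_disc" and "e > 0"
  shows "open (hol_nbhd f K e)"
  unfolding open_hol_disc_def
proof
  fix g assume "g \<in> hol_nbhd f K e"
  then have g: "\<And>z. z \<in> K \<Longrightarrow> dist (hol_fun g z) (hol_fun f z) < e"
    by (simp add: hol_nbhd_def)
  obtain r where r: "r > 0" "\<And>z. z \<in> K \<Longrightarrow> dist (hol_fun g z) (hol_fun f z) + r \<le> e"
  proof (cases "K = {}")
    case True
    then show ?thesis using that[of 1] by simp
  next
    case False
    have "continuous_on K (\<lambda>z. dist (hol_fun g z) (hol_fun f z))"
      by (intro continuous_intros holomorphic_on_imp_continuous_on
          holomorphic_on_subset[OF hol_fun_holomorphic K(2)])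
    then obtain w where w: "w \<in> K"
      "\<And>z. z \<in> K \<Longrightarrow> dist (hol_fun g z) (hol_fun f z) \<le> dist (hol_fun g w) (hol_fun f w)"
      using continuous_attains_sup[OF K(1) False] by meson
    show ?thesis
      using that[of "e - dist (hol_fun g w) (hol_fun f w)"] g[OF w(1)] w(2) by simp
  qed
  have "hol_nbhd g K r \<subseteq> hol_nbhd f K e"
  proof
    fix h assume h: "h \<in> hol_nbhd g K r"
    have "dist (hol_fun h z) (hol_fun f z) < e" if "z \<in> K" for z
    proof -
      have "dist (hol_fun h z) (hol_fun g z) < r" using h that by (simp add: hol_nbhd_def)
      then show ?thesis
        using r(2)[OF that] dist_triangle[of "hol_fun h z" "hol_fun f z" "hol_fun g z"] by linarith
    qed
    then show "h \<in> hol_nbhd f K e" by (simp add: hol_nbhd_def)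
  qed
  then show "\<exists>L r. compact L \<and> L \<subseteq> unit_disc \<and> r > 0 \<and> hol_nbhd g L r \<subseteq> hol_nbhd f K e"
    using K r(1) by meson
qed

lemma tendsto_hol_disc_iff:
  "(F \<longlongrightarrow> f) A \<longleftrightarrow>
     (\<forall>K. compact K \<and> K \<subseteq> unit_disc \<longrightarrow> uniform_limit K (\<lambda>n. hol_fun (F n)) (hol_fun f) A)"
proof (intro iffI allI impI)
  fix K assume lim: "(F \<longlongrightarrow> f) A" and K: "compact K \<and> K \<subseteq> unit_disc"
  show "uniform_limit K (\<lambda>n. hol_fun (F n)) (hol_fun f) A"
  proof (rule uniform_limitI)
    fix e :: real assume "e > 0"
    then have "\<forall>\<^sub>F n in A. F n \<in> hol_nbhd f K e"
      using K by (intro topological_tendstoD[OF lim] open_hol_nbhd) (auto simp: hol_nbhd_def)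
    then show "\<forall>\<^sub>F n in A. \<forall>z\<in>K. dist (hol_fun (F n) z) (hol_fun f z) < e"
      by (simp add: hol_nbhd_def)
  qed
next
  assume lim: "\<forall>K. compact K \<and> K \<subseteq> unit_disc \<longrightarrow>
    uniform_limit K (\<lambda>n. hol_fun (F n)) (hol_fun f) A"
  show "(F \<longlongrightarrow> f) A"
  proof (rule topological_tendstoI)
    fix S assume "open S" "f \<in> S"
    then obtain K e where K: "compact K" "K \<subseteq> unit_disc" "e > 0" "hol_nbhd f K e \<subseteq> S"
      unfolding open_hol_disc_def by meson
    have "\<forall>\<^sub>F n in A. \<forall>z\<in>K. dist (hol_fun (F n) z) (hol_fun f z) < e"
      using lim K(1-3) by (intro uniform_limitD) simp_all
    then show "\<forall>\<^sub>F n in A. F n \<in> S"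
      by (rule eventually_mono) (use K(4) in \<open>auto simp: hol_nbhd_def\<close>)
  qed
qed

definition continuous_linear_op :: "(hol_disc \<Rightarrow> hol_disc) \<Rightarrow> bool" where
  "continuous_linear_op T \<longleftrightarrow> Vector_Spaces.linear hol_scale hol_scale T \<and> continuous_on UNIV T"

definition rank_one_projection :: "(hol_disc \<Rightarrow> hol_disc) \<Rightarrow> bool" where
  "rank_one_projection T \<longleftrightarrow>
     continuous_linear_op T \<and> T \<circ> T = T \<and> hol.dim (range T) = 1"

definition disc_automorphism :: "(complex \<Rightarrow> complex) \<Rightarrow> bool" where
  "disc_automorphism \<phi> \<longleftrightarrow>
     \<phi> holomorphic_on unit_disc \<and> \<phi> ` unit_disc \<subseteq> unit_disc \<and>
     (\<exists>\<psi>. \<psi> holomorphic_on unit_disc \<and> \<psi> ` unit_disc \<subseteq> unit_disc \<and>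
        (\<forall>z\<in>unit_disc. \<psi> (\<phi> z) = z \<and> \<phi> (\<psi> z) = z))"

text \<open>Meaningful only for a holomorphic self-map \<open>\<phi>\<close> of the disc.\<close>

definition comp_op :: "(complex \<Rightarrow> complex) \<Rightarrow> hol_disc \<Rightarrow> hol_disc" where
  "comp_op \<phi> f = Abs_hol_disc (\<lambda>z. if z \<in> unit_disc then hol_fun f (\<phi> z) else 0)"

lemma hol_fun_comp_op:
  assumes "\<phi> holomorphic_on unit_disc" "\<phi> ` unit_disc \<subseteq> unit_disc" "z \<in> unit_disc"
  shows "hol_fun (comp_op \<phi> f) z = hol_fun f (\<phi> z)"
proof -
  have "(\<lambda>z. hol_fun f (\<phi> z)) holomorphic_on unit_disc"
    using holomorphic_on_compose_gen[OF assms(1) hol_fun_holomorphic assms(2)] by (simp add: o_def)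
  then show ?thesis
    unfolding comp_op_def using holomorphic_on_disc_extend_0 assms(3)
    by (subst Abs_hol_disc_inverse) auto
qed

text \<open>By Koenigs' theorem exactly one \<open>\<kappa>\<close> satisfies this when \<open>\<phi>\<close> is a holomorphic self-map of the
  disc that is not an automorphism, \<open>\<phi> \<alpha> = \<alpha>\<close> and \<open>deriv \<phi> \<alpha> \<noteq> 0\<close>.\<close>

definition koenigs_eigenfunction :: "(complex \<Rightarrow> complex) \<Rightarrow> complex \<Rightarrow> hol_disc \<Rightarrow> bool" where
  "koenigs_eigenfunction \<phi> \<alpha> \<kappa> \<longleftrightarrow>
     (\<forall>z\<in>unit_disc. hol_fun \<kappa> (\<phi> z) = deriv \<phi> \<alpha> * hol_fun \<kappa> z) \<and>
     deriv (hol_fun \<kappa>) \<alpha> = 1"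

fun koenigs_proj :: "complex \<Rightarrow> hol_disc \<Rightarrow> nat \<Rightarrow> hol_disc \<Rightarrow> hol_disc" where
  "koenigs_proj \<alpha> \<kappa> 0 f = hol_fun f \<alpha> *\<^sub>H 1"
| "koenigs_proj \<alpha> \<kappa> (Suc n) f =
     (let g = f - (\<Sum>k\<le>n. koenigs_proj \<alpha> \<kappa> k f)
      in ((1 / fact (Suc n)) * (deriv ^^ Suc n) (hol_fun g) \<alpha>) *\<^sub>H \<kappa> ^ Suc n)"

end

theory Submission
  imports Defs
begin

text \<open>By the Schwarz lemma \<open>\<phi>\<close> has multiplier different from \<open>1\<close> at \<open>\<alpha>\<close>, so \<open>\<kappa> \<alpha> = 0\<close> and \<open>\<kappa>\<close> is
  a local coordinate at \<open>\<alpha>\<close>. Hence the Taylor series of every \<open>f\<close> has a unique formal expansion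
  \<open>\<Sum>n. a n f * \<kappa> ^ n\<close>, whose coefficients are triangular in the Taylor coefficients of \<open>f\<close>, and
  \<open>P n f = a n f * \<kappa> ^ n\<close>. All algebraic claims follow from uniqueness of the expansion, since
  composition with \<open>\<phi>\<close> turns \<open>\<kappa> ^ n\<close> into \<open>deriv \<phi> \<alpha> ^ n * \<kappa> ^ n\<close>; continuity of \<open>P n\<close> is
  continuity of the derivatives at \<open>\<alpha>\<close>.\<close>

unbundle no vec_syntax

section \<open>Expansion of a power series in powers of another one\<close>

text \<open>If \<open>K\<close> has constant term 0 and linear coefficient 1, this is the
  coefficient of \<open>K ^ n\<close> in the formal expansion of \<open>G\<close> in powers of
  \<open>K\<close>, found by forward substitution. Since \<open>(K ^ n) $ n\<close> is then 1, no
  division occurs.\<close>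

fun power_coeff :: "'a::idom fps \<Rightarrow> nat \<Rightarrow> 'a fps \<Rightarrow> 'a" where
  "power_coeff K n G = G $ n - (\<Sum>k<n. power_coeff K k G * (K ^ k) $ n)"

declare power_coeff.simps [simp del]

text \<open>The linear system is lower triangular with unit diagonal: \<open>K ^ k\<close> starts in
  degree k with coefficient 1. Hence the recursion at l is the identity with upper bound l, and the
  terms with k > l vanish.\<close>

lemma fps_nth_eq_sum_power_coeff:
  assumes "K $ 0 = 0" "K $ 1 = 1" "l \<le> n"
  shows "G $ l = (\<Sum>k\<le>n. power_coeff K k G * (K ^ k) $ l)"
proof -
  have "G $ l = (\<Sum>k\<le>l. power_coeff K k G * (K ^ k) $ l)"
    using assms by (simp add: lessThan_Suc_atMost[symmetric] power_coeff.simps[of K l]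
        startsby_zero_power_nth_same)
  also have "\<dots> = (\<Sum>k\<le>n. power_coeff K k G * (K ^ k) $ l)"
    using assms by (intro sum.mono_neutral_left) (auto simp: startsby_zero_power_prefix)
  finally show ?thesis .
qed

text \<open>Forward substitution determines the solution uniquely. Later identities for the
  coefficients are proved by guessing a candidate \<open>b\<close> and checking the
  expansion.\<close>

lemma power_coeff_eqI:
  assumes K: "K $ 0 = 0" "K $ 1 = 1"
    and G: "\<And>l. l \<le> n \<Longrightarrow> G $ l = (\<Sum>k\<le>l. b k * (K ^ k) $ l)"
  shows "power_coeff K n G = b n"
  using G
proof (induction n rule: less_induct)
  case (less n)
  have "power_coeff K k G = b k" if "k < n" for k
    using less.prems that by (intro less.IH) auto
  then show ?case
    using less.prems[of n] K
    by (simp add: power_coeff.simps[of K n] lessThan_Suc_atMost[symmetric]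
        startsby_zero_power_nth_same)
qed

lemma
  assumes K: "K $ 0 = 0" "K $ 1 = 1"
  shows power_coeff_add: "power_coeff K n (G + H) = power_coeff K n G + power_coeff K n H"
    and power_coeff_const_mult: "power_coeff K n (fps_const c * G) = c * power_coeff K n G"
    and power_coeff_power: "power_coeff K n (K ^ m) = (if n = m then 1 else 0)"
proof -
  show "power_coeff K n (G + H) = power_coeff K n G + power_coeff K n H"
    by (rule power_coeff_eqI[OF K])
      (simp add: distrib_right sum.distrib flip: fps_nth_eq_sum_power_coeff[OF K order_refl])
  show "power_coeff K n (fps_const c * G) = c * power_coeff K n G"
    by (rule power_coeff_eqI[OF K])
      (simp add: mult.assoc flip: sum_distrib_left fps_nth_eq_sum_power_coeff[OF K order_refl])
  \<comment> \<open>The candidate is the Kronecker delta; in degrees l < m both the sum and the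
    coefficient of \<open>K ^ m\<close> are 0.\<close>
  show "power_coeff K n (K ^ m) = (if n = m then 1 else 0)"
    by (rule power_coeff_eqI[OF K])
      (use K(1) in \<open>simp add: if_distrib[of "\<lambda>c. c * _"] startsby_zero_power_prefix cong: if_cong\<close>)
qed

lemma power_coeff_linear_combination:
  "\<exists>c. \<forall>G. power_coeff K n G = (\<Sum>m\<le>n. c m * G $ m)"
proof (induction n rule: less_induct)
  case (less n)
  then obtain c where c: "\<And>k G. k < n \<Longrightarrow> power_coeff K k G = (\<Sum>m\<le>k. c k m * G $ m)"
    by metis
  \<comment> \<open>Padding with zeros gives all inner sums the same index range, so that the double
    sum can be swapped.\<close>
  define d where "d k m = (if m \<le> k then c k m else 0)" for k m
  have d: "power_coeff K k G = (\<Sum>m<n. d k m * G $ m)" if "k < n" for k G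
  proof -
    have "(\<Sum>m\<le>k. c k m * G $ m) = (\<Sum>m<n. d k m * G $ m)"
      using that by (intro sum.mono_neutral_cong_left) (auto simp: d_def)
    then show ?thesis by (simp add: c that)
  qed
  have "power_coeff K n G =
      (\<Sum>m\<le>n. (if m = n then 1 else - (\<Sum>k<n. d k m * (K ^ k) $ n)) * G $ m)" for G
  proof -
    have "(\<Sum>k<n. power_coeff K k G * (K ^ k) $ n) =
        (\<Sum>m<n. (\<Sum>k<n. d k m * (K ^ k) $ n) * G $ m)"
      unfolding sum_distrib_right
      by (subst sum.swap) (simp add: d sum_distrib_left sum_distrib_right mult_ac)
    then show ?thesis
      by (simp add: power_coeff.simps[of K n] lessThan_Suc_atMost[symmetric] sum_negf)
  qed
  then show ?case by (intro exI allI)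
qed

text \<open>Composition with \<Phi> multiplies \<open>K ^ k\<close> by \<open>c ^ k\<close>, so it
  turns an expansion of \<open>G\<close> into one of \<open>G oo \<Phi>\<close> with k-th
  coefficient scaled by \<open>c ^ k\<close>; uniqueness does the rest.\<close>

lemma power_coeff_compose:
  assumes K: "K $ 0 = 0" "K $ 1 = 1" and \<Phi>: "\<Phi> $ 0 = 0" "K oo \<Phi> = fps_const c * K"
  shows "power_coeff K n (G oo \<Phi>) = c ^ n * power_coeff K n G"
proof (rule power_coeff_eqI[OF K])
  fix l
  \<comment> \<open>Coefficient l of a composition sees the outer series only up to degree l, so the
    finite partial expansion \<open>H\<close> may replace \<open>G\<close>.\<close>
  define H where "H = (\<Sum>k\<le>l. fps_const (power_coeff K k G) * K ^ k)"
  have H: "G $ i = H $ i" if "i \<le> l" for i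
    using fps_nth_eq_sum_power_coeff[OF K that, of G] by (simp add: H_def fps_sum_nth)
  have "(G oo \<Phi>) $ l = (H oo \<Phi>) $ l"
    by (simp add: fps_compose_nth H)
  also have "H oo \<Phi> = (\<Sum>k\<le>l. fps_const (power_coeff K k G) * (fps_const c * K) ^ k)"
    by (simp add: H_def fps_compose_sum_distrib fps_compose_mult_distrib[OF \<Phi>(1)]
        \<Phi>(2) flip: fps_compose_power[OF \<Phi>(1)])
  also have "\<dots> $ l = (\<Sum>k\<le>l. c ^ k * power_coeff K k G * (K ^ k) $ l)"
    by (simp add: fps_sum_nth power_mult_distrib fps_const_power mult.assoc mult.left_commute)
  finally show "(G oo \<Phi>) $ l = (\<Sum>k\<le>l. c ^ k * power_coeff K k G * (K ^ k) $ l)" .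
qed


section \<open>Taylor series of functions on the disc\<close>

lemma hol_fun_0 [simp]: "hol_fun 0 z = 0"
  and hol_fun_add: "hol_fun (f + g) z = hol_fun f z + hol_fun g z"
  and hol_fun_diff: "hol_fun (f - g) z = hol_fun f z - hol_fun g z"
  and hol_fun_mult: "hol_fun (f * g) z = hol_fun f z * hol_fun g z"
  and hol_fun_scale: "hol_fun (c *\<^sub>H f) z = c * hol_fun f z"
  and hol_fun_1: "z \<in> unit_disc \<Longrightarrow> hol_fun 1 z = 1"
  by (transfer; simp)+

lemma hol_fun_power: "z \<in> unit_disc \<Longrightarrow> hol_fun (f ^ n) z = hol_fun f z ^ n"
  by (induction n) (simp_all add: hol_fun_1 hol_fun_mult)

definition taylor :: "complex \<Rightarrow> hol_disc \<Rightarrow> complex fps" where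
  "taylor \<alpha> f = fps_expansion (hol_fun f) \<alpha>"

lemma taylor_nth: "taylor \<alpha> f $ n = (deriv ^^ n) (hol_fun f) \<alpha> / fact n"
  by (simp add: taylor_def fps_expansion_def)

context
  fixes \<alpha> :: complex
  assumes \<alpha>: "\<alpha> \<in> unit_disc"
begin

lemma has_fps_expansion_taylor: "(\<lambda>x. hol_fun f (\<alpha> + x)) has_fps_expansion taylor \<alpha> f"
  unfolding taylor_def
  using \<alpha> hol_fun_holomorphic[of f] open_ball
  by (intro analytic_at_imp_has_fps_expansion) (unfold analytic_at, blast)

lemma eventually_nhds_disc: "\<forall>\<^sub>F x in nhds 0. \<alpha> + x \<in> unit_disc"
proof -
  have "((\<lambda>x. \<alpha> + x) \<longlongrightarrow> \<alpha> + 0) (nhds 0)"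
    by (intro tendsto_intros filterlim_ident)
  then show ?thesis
    using topological_tendstoD[of "\<lambda>x. \<alpha> + x" \<alpha> "nhds 0" unit_disc] \<alpha> by simp
qed

lemma taylor_eqI:
  assumes "F has_fps_expansion G" "\<And>x. \<alpha> + x \<in> unit_disc \<Longrightarrow> hol_fun f (\<alpha> + x) = F x"
  shows "taylor \<alpha> f = G"
proof -
  have "\<forall>\<^sub>F x in nhds 0. F x = hol_fun f (\<alpha> + x)"
    using eventually_nhds_disc by eventually_elim (simp add: assms(2))
  then have "(\<lambda>x. hol_fun f (\<alpha> + x)) has_fps_expansion G"
    using assms(1) has_fps_expansion_cong[of F "\<lambda>x. hol_fun f (\<alpha> + x)" G G] by simp
  then show ?thesis
    using has_fps_expansion_taylor fps_expansion_unique_complex by blast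
qed

lemma taylor_add: "taylor \<alpha> (f + g) = taylor \<alpha> f + taylor \<alpha> g"
  by (rule taylor_eqI[OF has_fps_expansion_add[OF has_fps_expansion_taylor has_fps_expansion_taylor]])
    (simp add: hol_fun_add)

lemma taylor_diff: "taylor \<alpha> (f - g) = taylor \<alpha> f - taylor \<alpha> g"
  by (rule taylor_eqI[OF has_fps_expansion_diff[OF has_fps_expansion_taylor has_fps_expansion_taylor]])
    (simp add: hol_fun_diff)

lemma taylor_mult: "taylor \<alpha> (f * g) = taylor \<alpha> f * taylor \<alpha> g"
  by (rule taylor_eqI[OF has_fps_expansion_mult[OF has_fps_expansion_taylor has_fps_expansion_taylor]])
    (simp add: hol_fun_mult)

lemma taylor_scale: "taylor \<alpha> (c *\<^sub>H f) = fps_const c * taylor \<alpha> f"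
  by (rule taylor_eqI[OF has_fps_expansion_cmult_left[OF has_fps_expansion_taylor]])
    (simp add: hol_fun_scale)

lemma taylor_0: "taylor \<alpha> 0 = 0"
  by (rule taylor_eqI[OF has_fps_expansion_0]) simp

lemma taylor_1: "taylor \<alpha> 1 = 1"
  by (rule taylor_eqI[OF has_fps_expansion_1]) (simp add: hol_fun_1)

lemma taylor_power: "taylor \<alpha> (f ^ n) = taylor \<alpha> f ^ n"
  by (induction n) (simp_all add: taylor_1 taylor_mult)

lemma taylor_sum: "taylor \<alpha> (sum f A) = (\<Sum>x\<in>A. taylor \<alpha> (f x))"
  by (induction A rule: infinite_finite_induct) (simp_all add: taylor_0 taylor_add)

text \<open>Formal composition needs an inner series without constant term, so the inner function is
  the increment of \<phi> at its fixed point \<alpha>.\<close>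

lemma taylor_comp_op:
  assumes \<phi>: "\<phi> holomorphic_on unit_disc" "\<phi> ` unit_disc \<subseteq> unit_disc" "\<phi> \<alpha> = \<alpha>"
  shows "taylor \<alpha> (comp_op \<phi> f) = taylor \<alpha> f oo (fps_expansion \<phi> \<alpha> - fps_const \<alpha>)"
proof (rule taylor_eqI)
  have "(\<lambda>x. \<phi> (\<alpha> + x)) has_fps_expansion fps_expansion \<phi> \<alpha>"
    using \<alpha> \<phi>(1) open_ball
    by (intro analytic_at_imp_has_fps_expansion) (unfold analytic_at, blast)
  then have "(\<lambda>x. \<phi> (\<alpha> + x) - \<alpha>) has_fps_expansion fps_expansion \<phi> \<alpha> - fps_const \<alpha>"
    by (intro has_fps_expansion_diff has_fps_expansion_const)
  moreover have "(fps_expansion \<phi> \<alpha> - fps_const \<alpha>) $ 0 = 0"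
    by (simp add: fps_expansion_def \<phi>(3))
  ultimately show "((\<lambda>x. hol_fun f (\<alpha> + x)) \<circ> (\<lambda>x. \<phi> (\<alpha> + x) - \<alpha>))
      has_fps_expansion (taylor \<alpha> f oo (fps_expansion \<phi> \<alpha> - fps_const \<alpha>))"
    by (intro has_fps_expansion_compose has_fps_expansion_taylor)
qed (simp add: hol_fun_comp_op[OF \<phi>(1,2)] del: mem_ball mem_ball_0)

text \<open>Weierstrass: uniform convergence on a closed disc around \<alpha> forces convergence of
  all derivatives at its centre.\<close>

lemma continuous_higher_deriv: "continuous_on UNIV (\<lambda>f. (deriv ^^ m) (hol_fun f) \<alpha>)"
  unfolding continuous_on_def
proof
  fix f :: hol_disc
  obtain r where r: "r > 0" "cball \<alpha> r \<subseteq> unit_disc"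
    using \<alpha> open_contains_cball[of unit_disc] open_ball by blast
  have "((\<lambda>f. f) \<longlongrightarrow> f) (at f)"
    by (rule tendsto_ident_at)
  then have "uniform_limit (cball \<alpha> r) hol_fun (hol_fun f) (at f)"
    using r(2) compact_cball unfolding tendsto_hol_disc_iff by blast
  then have lim: "uniform_limit (ball \<alpha> r) hol_fun (hol_fun f) (at f)"
    by (rule uniform_limit_on_subset) auto
  have "\<forall>\<^sub>F g in at f. hol_fun g holomorphic_on ball \<alpha> r"
    using r(2) ball_subset_cball
    by (intro always_eventually allI holomorphic_on_subset[OF hol_fun_holomorphic]) blast
  then show "((\<lambda>g. (deriv ^^ m) (hol_fun g) \<alpha>) \<longlongrightarrow> (deriv ^^ m) (hol_fun f) \<alpha>) (at f)"
    using lim r(1)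
    \<comment> \<open>The convergence theorem for derivatives needs a nontrivial filter; for the
      trivial one every limit holds.\<close>
    by (cases "at f = bot") (auto intro: higher_deriv_complex_uniform_limit)
qed

end

text \<open>On a compact set the fixed function \<open>h\<close> is bounded, so convergence of the
  scalars makes the products converge uniformly.\<close>

lemma continuous_scale_fixed:
  assumes "continuous_on UNIV a"
  shows "continuous_on UNIV (\<lambda>f :: hol_disc. a f *\<^sub>H h)"
  unfolding continuous_on_def tendsto_hol_disc_iff
proof (intro ballI allI impI)
  fix f :: hol_disc and K assume K: "compact K \<and> K \<subseteq> unit_disc"
  have lim: "(a \<longlongrightarrow> a f) (at f)"
    using assms by (simp add: continuous_on_def)
  have "uniform_limit K (\<lambda>g _. a g) (\<lambda>_. a f) (at f)"
    using lim by (auto simp: uniform_limit_iff tendsto_iff)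
  moreover have "bounded ((\<lambda>_. a f) ` K)"
    by (rule bounded_subset[of "{a f}"]) auto
  moreover have "bounded (hol_fun h ` K)"
    using K by (intro compact_imp_bounded compact_continuous_image
        holomorphic_on_imp_continuous_on[OF holomorphic_on_subset[OF hol_fun_holomorphic]]) auto
  ultimately show "uniform_limit K (\<lambda>g. hol_fun (a g *\<^sub>H h)) (hol_fun (a f *\<^sub>H h)) (at f)"
    unfolding hol_fun_scale[abs_def] by (intro uniform_limit_intros) auto
qed

lemma linear_scale_fixed:
  assumes "\<And>f g. a (f + g) = a f + a g" "\<And>c f. a (c *\<^sub>H f) = c * a f"
  shows "Vector_Spaces.linear hol_scale hol_scale (\<lambda>f. a f *\<^sub>H h)"
  unfolding linear_iff_module_hom module_hom_iff
  using assms hol.module_axioms by (simp add: hol.scale_left_distrib)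


section \<open>The multiplier at the fixed point\<close>

text \<open>After conjugation by a disc automorphism moving \<alpha> to 0, multiplier 1 is the
  equality case of the Schwarz lemma: the conjugate is a rotation with derivative 1, so \<phi> is
  the identity on the disc.\<close>

lemma deriv_fixed_point_ne_1:
  assumes \<phi>: "\<phi> holomorphic_on unit_disc" "\<phi> ` unit_disc \<subseteq> unit_disc" "\<phi> \<alpha> = \<alpha>"
    and \<alpha>: "\<alpha> \<in> unit_disc" and "\<not> disc_automorphism \<phi>"
  shows "deriv \<phi> \<alpha> \<noteq> 1"
proof
  assume deriv: "deriv \<phi> \<alpha> = 1"
  obtain f g where fg: "f \<alpha> = 0"
    "f holomorphic_on unit_disc" "f ` unit_disc \<subseteq> unit_disc"
    "g holomorphic_on unit_disc" "g ` unit_disc \<subseteq> unit_disc"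
    "\<And>z. z \<in> unit_disc \<Longrightarrow> f (g z) = z" "\<And>z. z \<in> unit_disc \<Longrightarrow> g (f z) = z"
    using ball_biholomorphism_exists[OF \<alpha>] by metis
  have g0: "g 0 = \<alpha>" using fg(1,7) \<alpha> by metis
  have mem: "f z \<in> unit_disc" "g z \<in> unit_disc" "\<phi> z \<in> unit_disc" if "z \<in> unit_disc" for z
    using fg(3,5) \<phi>(2) that by blast+
  define \<psi> where "\<psi> = f \<circ> \<phi> \<circ> g"
  have hol: "\<psi> holomorphic_on unit_disc"
    unfolding \<psi>_def using fg \<phi>
    by (intro holomorphic_on_compose_gen[OF _ holomorphic_on_compose_gen] image_subsetI)
      (auto simp del: mem_ball mem_ball_0 intro!: mem)
  have D: "(f has_field_derivative deriv f \<alpha>) (at \<alpha>)" "(g has_field_derivative deriv g 0) (at 0)"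
    "(\<phi> has_field_derivative 1) (at \<alpha>)"
    using holomorphic_derivI[OF fg(2) open_ball \<alpha>] holomorphic_derivI[OF fg(4) open_ball, of 0]
      holomorphic_derivI[OF \<phi>(1) open_ball \<alpha>] deriv by auto
  \<comment> \<open>As \<open>f\<close> and \<open>g\<close> are mutually inverse, their derivatives
    cancel in the chain rule and conjugation keeps the multiplier.\<close>
  have "((f \<circ> g) has_field_derivative deriv f \<alpha> * deriv g 0) (at 0)"
    using D g0 by (auto intro: DERIV_chain)
  moreover have "((f \<circ> g) has_field_derivative 1) (at 0)"
    by (rule has_field_derivative_transform_within_open[OF DERIV_ident open_ball[of 0 1]])
      (auto simp: fg(6))
  ultimately have inv: "deriv f \<alpha> * deriv g 0 = 1"
    using DERIV_unique by blast
  have "(\<psi> has_field_derivative deriv f \<alpha> * 1 * deriv g 0) (at 0)"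
    unfolding \<psi>_def using D g0 \<phi>(3) by (intro DERIV_chain) auto
  then have d\<psi>: "deriv \<psi> 0 = 1"
    using inv by (simp add: DERIV_imp_deriv)
  have "\<psi> 0 = 0" by (simp add: \<psi>_def g0 \<phi>(3) fg(1))
  moreover have "norm (\<psi> z) < 1" if "norm z < 1" for z
    using mem(1)[OF mem(3)[OF mem(2)[of z]]] that by (simp add: \<psi>_def)
  ultimately obtain a where a: "\<And>z. norm z < 1 \<Longrightarrow> \<psi> z = a * z"
    using Schwarz_Lemma(3)[OF hol, of 0] d\<psi> by auto
  have "((\<lambda>z. a * z) has_field_derivative a) (at 0)"
    by (auto intro!: derivative_eq_intros)
  then have "(\<psi> has_field_derivative a) (at 0)"
    by (rule has_field_derivative_transform_within_open[OF _ open_ball[of 0 1]]) (auto simp: a)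
  then have "a = 1" using d\<psi> by (simp add: DERIV_imp_deriv)
  have "\<phi> z = z" if z: "z \<in> unit_disc" for z
  proof -
    have "f (\<phi> z) = f z"
      using a[of "f z"] mem(1)[OF z] fg(7)[OF z] \<open>a = 1\<close> by (simp add: \<psi>_def)
    then show ?thesis using fg(7) mem(3) z by metis
  qed
  then have "disc_automorphism \<phi>"
    unfolding disc_automorphism_def using \<phi>
    by (intro conjI exI[of _ "\<lambda>z. z"]) auto
  with assms show False by simp
qed


section \<open>The projections\<close>

text \<open>The n-th derivative over n! is the n-th Taylor coefficient, and subtracting the earlier
  projections is the subtraction in the recursion of \<open>power_coeff\<close>.\<close>

lemma koenigs_proj_eq_power_coeff:
  assumes \<alpha>: "\<alpha> \<in> unit_disc"
  shows "koenigs_proj \<alpha> \<kappa> n f = power_coeff (taylor \<alpha> \<kappa>) n (taylor \<alpha> f) *\<^sub>H \<kappa> ^ n"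
proof (induction n rule: less_induct)
  case (less n)
  show ?case
  proof (cases n)
    case 0
    then show ?thesis by (simp add: power_coeff.simps[of _ 0] taylor_nth)
  next
    case (Suc m)
    define a where "a k = power_coeff (taylor \<alpha> \<kappa>) k (taylor \<alpha> f)" for k
    have "(\<Sum>k\<le>m. koenigs_proj \<alpha> \<kappa> k f) = (\<Sum>k<n. a k *\<^sub>H \<kappa> ^ k)"
      unfolding Suc lessThan_Suc_atMost a_def using less Suc by (intro sum.cong) auto
    then have "koenigs_proj \<alpha> \<kappa> n f = (taylor \<alpha> (f - (\<Sum>k<n. a k *\<^sub>H \<kappa> ^ k)) $ n) *\<^sub>H \<kappa> ^ n"
      by (simp add: Suc taylor_nth Let_def del: funpow.simps power_Suc)
    also have "taylor \<alpha> (f - (\<Sum>k<n. a k *\<^sub>H \<kappa> ^ k)) $ n = a n"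
      by (simp add: taylor_diff taylor_sum taylor_scale taylor_power \<alpha> fps_sum_nth a_def
          power_coeff.simps[of _ n] del: mem_ball mem_ball_0)
    finally show ?thesis by (simp add: a_def)
  qed
qed

theorem theorem3p2:
  fixes \<phi> :: "complex \<Rightarrow> complex" and \<alpha> :: complex and \<kappa> :: hol_disc
    and P :: "nat \<Rightarrow> hol_disc \<Rightarrow> hol_disc" and ev :: "nat \<Rightarrow> complex"
  assumes "\<phi> holomorphic_on unit_disc" and "\<phi> ` unit_disc \<subseteq> unit_disc"
    and "\<not> disc_automorphism \<phi>"
    and "\<alpha> \<in> unit_disc" and "\<phi> \<alpha> = \<alpha>" and "deriv \<phi> \<alpha> \<noteq> 0"
    and "koenigs_eigenfunction \<phi> \<alpha> \<kappa>"
  defines "P \<equiv> koenigs_proj \<alpha> \<kappa>"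
    and "ev \<equiv> \<lambda>n. deriv \<phi> \<alpha> ^ n"
  shows "(\<forall>n. rank_one_projection (P n)) \<and>
    (\<forall>n. P n \<circ> comp_op \<phi> = comp_op \<phi> \<circ> P n \<and>
         comp_op \<phi> \<circ> P n = (\<lambda>f. ev n *\<^sub>H P n f)) \<and>
    (\<forall>n l f. l \<le> n \<longrightarrow>
         (deriv ^^ l) (hol_fun f) \<alpha> = (deriv ^^ l) (hol_fun (\<Sum>k\<le>n. P k f)) \<alpha>) \<and>
    (\<exists>c :: nat \<Rightarrow> nat \<Rightarrow> complex. \<forall>n f.
         P n f = (\<Sum>m\<le>n. c n m * (deriv ^^ m) (hol_fun f) \<alpha>) *\<^sub>H \<kappa> ^ n) \<and>
    (\<forall>n m. P n \<circ> P m = (if n = m then P n else (\<lambda>_. 0)))"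
proof -
  note \<phi> = assms(1,2,5) and \<alpha> = assms(4)
  define K where "K = taylor \<alpha> \<kappa>"
  define a where "a n f = power_coeff K n (taylor \<alpha> f)" for n f
  define \<Phi> where "\<Phi> = fps_expansion \<phi> \<alpha> - fps_const \<alpha>"
  have P: "P n f = a n f *\<^sub>H \<kappa> ^ n" for n f
    by (simp add: P_def a_def K_def koenigs_proj_eq_power_coeff[OF \<alpha>])
  have eigen: "hol_fun \<kappa> (\<phi> z) = deriv \<phi> \<alpha> * hol_fun \<kappa> z" if "z \<in> unit_disc" for z
    using assms(7) that by (simp add: koenigs_eigenfunction_def)

  \<comment> \<open>Koenigs' equation at the fixed point, with multiplier different from 1, forces
    \<kappa> to vanish there.\<close>
  have "hol_fun \<kappa> \<alpha> = deriv \<phi> \<alpha> * hol_fun \<kappa> \<alpha>"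
    using eigen[OF \<alpha>] by (simp add: \<phi>(3))
  then have "hol_fun \<kappa> \<alpha> = 0"
    using deriv_fixed_point_ne_1[OF \<phi> \<alpha> assms(3)] by auto
  then have K: "K $ 0 = 0" "K $ 1 = 1"
    using assms(7) by (simp_all add: K_def taylor_nth koenigs_eigenfunction_def)
  \<comment> \<open>The functionals \<open>a n\<close> are biorthogonal to the powers of \<kappa>;
    this yields (d) and later \<open>\<kappa> ^ n \<noteq> 0\<close>.\<close>
  have a_power: "a n (\<kappa> ^ m) = (if n = m then 1 else 0)" for n m
    by (simp add: a_def taylor_power[OF \<alpha>] power_coeff_power[OF K] flip: K_def)
  have a_add: "a n (f + g) = a n f + a n g" for n f g
    by (simp add: a_def taylor_add[OF \<alpha>] power_coeff_add[OF K])
  have a_scale: "a n (c *\<^sub>H f) = c * a n f" for n c f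
    by (simp add: a_def taylor_scale[OF \<alpha>] power_coeff_const_mult[OF K])

  \<comment> \<open>This handles composition after \<open>P n\<close>; \<open>a_comp\<close> below
    handles composition before it. Together they give (a).\<close>
  have comp_power: "comp_op \<phi> (c *\<^sub>H \<kappa> ^ n) = (c * ev n) *\<^sub>H \<kappa> ^ n" for c n
  proof (rule hol_disc_eqI)
    fix z assume z: "z \<in> unit_disc"
    then have "\<phi> z \<in> unit_disc" using \<phi>(2) by blast
    with z show "hol_fun (comp_op \<phi> (c *\<^sub>H \<kappa> ^ n)) z = hol_fun ((c * ev n) *\<^sub>H \<kappa> ^ n) z"
      by (simp add: hol_fun_comp_op[OF \<phi>(1,2)] hol_fun_scale hol_fun_power eigen ev_def
          power_mult_distrib del: mem_ball mem_ball_0)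
  qed
  have \<Phi>0: "\<Phi> $ 0 = 0"
    by (simp add: \<Phi>_def fps_expansion_def \<phi>(3))
  have "comp_op \<phi> \<kappa> = deriv \<phi> \<alpha> *\<^sub>H \<kappa>"
    using comp_power[of 1 1] by (simp add: ev_def)
  then have "K oo \<Phi> = fps_const (deriv \<phi> \<alpha>) * K"
    by (simp add: K_def \<Phi>_def taylor_scale[OF \<alpha>] flip: taylor_comp_op[OF \<alpha> \<phi>])
  then have a_comp: "a n (comp_op \<phi> f) = ev n * a n f" for n f
    by (simp add: a_def ev_def taylor_comp_op[OF \<alpha> \<phi>] power_coeff_compose[OF K \<Phi>0] flip: \<Phi>_def)

  obtain c where c: "\<And>n G. power_coeff K n G = (\<Sum>m\<le>n. c n m * G $ m)"
    using power_coeff_linear_combination[of K] by metis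
  have a_deriv: "a n f = (\<Sum>m\<le>n. c n m / fact m * (deriv ^^ m) (hol_fun f) \<alpha>)" for n f
    by (simp add: a_def c taylor_nth)

  have PP: "P n \<circ> P m = (if n = m then P n else (\<lambda>_. 0))" for n m
    by (auto simp: fun_eq_iff P a_scale a_power)

  have "rank_one_projection (P n)" for n
  proof -
    have "Vector_Spaces.linear hol_scale hol_scale (P n)"
      unfolding P[abs_def] by (rule linear_scale_fixed[OF a_add a_scale])
    moreover have "continuous_on UNIV (P n)"
      unfolding P[abs_def] a_deriv
      by (intro continuous_scale_fixed continuous_intros continuous_higher_deriv[OF \<alpha>])
    \<comment> \<open>\<open>\<kappa> ^ n\<close> is a basis of the range: it is fixed by
      \<open>P n\<close>, and it is nonzero because \<open>a n\<close> is 1 there.\<close>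
    moreover have "hol.dim (range (P n)) = 1"
    proof (rule hol.dim_unique)
      have "P n (\<kappa> ^ n) = \<kappa> ^ n" by (simp add: P a_power)
      then show "{\<kappa> ^ n} \<subseteq> range (P n)" by (metis empty_subsetI insert_subset rangeI)
      show "range (P n) \<subseteq> hol.span {\<kappa> ^ n}"
        by (auto simp: P intro: hol.span_scale hol.span_base)
      have "a n 0 = 0" using a_scale[of n 0 0] by simp
      then have "\<kappa> ^ n \<noteq> 0" using a_power[of n n] by auto
      then show "\<not> hol.dependent {\<kappa> ^ n}" by simp
    qed simp
    ultimately show ?thesis
      using PP[of n n] by (simp add: rank_one_projection_def continuous_linear_op_def)
  qed
  moreover have "P n \<circ> comp_op \<phi> = comp_op \<phi> \<circ> P n \<and>
      comp_op \<phi> \<circ> P n = (\<lambda>f. ev n *\<^sub>H P n f)" for n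
    by (simp add: fun_eq_iff P a_comp comp_power mult.commute)
  moreover have "(deriv ^^ l) (hol_fun f) \<alpha> = (deriv ^^ l) (hol_fun (\<Sum>k\<le>n. P k f)) \<alpha>"
    if "l \<le> n" for n l f
  proof -
    \<comment> \<open>For (b), the sum of the projections is the partial expansion in powers of
      \<kappa>, whose Taylor series agrees with that of \<open>f\<close> up to degree n.\<close>
    have "taylor \<alpha> f $ l = taylor \<alpha> (\<Sum>k\<le>n. P k f) $ l"
      using fps_nth_eq_sum_power_coeff[OF K that, of "taylor \<alpha> f"]
      by (simp add: P a_def taylor_sum[OF \<alpha>] taylor_scale[OF \<alpha>] taylor_power[OF \<alpha>] fps_sum_nth
          flip: K_def)
    then show ?thesis by (simp add: taylor_nth)
  qed
  moreover have "\<exists>c :: nat \<Rightarrow> nat \<Rightarrow> complex. \<forall>n f.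
      P n f = (\<Sum>m\<le>n. c n m * (deriv ^^ m) (hol_fun f) \<alpha>) *\<^sub>H \<kappa> ^ n"
    \<comment> \<open>The factor \<open>1 / fact m\<close> converts Taylor coefficients into
      derivatives.\<close>
    by (rule exI[of _ "\<lambda>n m. c n m / fact m"]) (simp add: P a_deriv)
  ultimately show ?thesis using PP by blast
qed

end
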